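(* Let $1\le p<\infty$ and let $T$ be the backward unilateral weighted shift on $\ell^p(\mathbb{N})$ with weight sequence $\{\frac{1}{n+1}\}_{n=0}^\infty$, i.e. $Te_0=0$ and $Te_n=\frac1n e_{n-1}$ for all $n\ge 1$. Then $\Lambda(T)=[0,1]$.
   Context: $\ell^p(\mathbb{N})$ is the complex Banach space of $p$-summable complex sequences indexed by $\mathbb{N}=\{0,1,2,\dots\}$, with canonical basis $\{e_n\}_{n=0}^\infty$. A bounded operator $T$ on a complex Banach space $X$ is quasinilpotent if its spectrum is $\{0\}$ (the operator $T$ in the claim is quasinilpotent). For quasinilpotent $T$ and $x\in X\setminus\{0\}$, $$k_x=k_{(T,x)}=\limsup_{z\to 0}\frac{\ln\|(z-T)^{-1}x\|}{\ln\|(z-T)^{-1}\|}$$ ($z\in\mathbb{C}\setminus\{0\}$), and the power set of $T$ is $\Lambda(T)=\{k_x: x\in X\setminus\{0\}\}$. *)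

theory Defs
  imports "HOL-Analysis.Analysis"
begin

section \<open>The sequence space and its bounded operators\<close>

text \<open>
  The exponent is a term-level parameter, so the space is a carrier set of sequences with the
  pointwise vector space operations, and operators are total functions on all sequences of
  which only the behaviour on the carrier matters.
\<close>

definition lp :: "real \<Rightarrow> (nat \<Rightarrow> complex) set" where
  "lp p = {x. summable (\<lambda>n. cmod (x n) powr p)}"

definition lp_norm :: "real \<Rightarrow> (nat \<Rightarrow> complex) \<Rightarrow> real" where
  "lp_norm p x = (\<Sum>n. cmod (x n) powr p) powr (1 / p)"

definition unit_seq :: "nat \<Rightarrow> nat \<Rightarrow> complex" where
  "unit_seq k = (\<lambda>n. if n = k then 1 else 0)"

definition lp_bounded_operator :: "real \<Rightarrow> ((nat \<Rightarrow> complex) \<Rightarrow> (nat \<Rightarrow> complex)) \<Rightarrow> bool" where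
  "lp_bounded_operator p S \<longleftrightarrow>
     (\<forall>x\<in>lp p. S x \<in> lp p) \<and>
     (\<forall>x\<in>lp p. \<forall>y\<in>lp p. S (\<lambda>n. x n + y n) = (\<lambda>n. S x n + S y n)) \<and>
     (\<forall>c. \<forall>x\<in>lp p. S (\<lambda>n. c * x n) = (\<lambda>n. c * S x n)) \<and>
     (\<exists>C. \<forall>x\<in>lp p. lp_norm p (S x) \<le> C * lp_norm p x)"

definition lp_opnorm :: "real \<Rightarrow> ((nat \<Rightarrow> complex) \<Rightarrow> (nat \<Rightarrow> complex)) \<Rightarrow> real" where
  "lp_opnorm p S = (SUP x\<in>{x\<in>lp p. lp_norm p x \<le> 1}. lp_norm p (S x))"


section \<open>Spectrum, resolvent and power set\<close>

definition scalar_minus ::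
    "complex \<Rightarrow> ((nat \<Rightarrow> complex) \<Rightarrow> (nat \<Rightarrow> complex)) \<Rightarrow> (nat \<Rightarrow> complex) \<Rightarrow> (nat \<Rightarrow> complex)" where
  "scalar_minus z T x = (\<lambda>n. z * x n - T x n)"

definition lp_spectrum :: "real \<Rightarrow> ((nat \<Rightarrow> complex) \<Rightarrow> (nat \<Rightarrow> complex)) \<Rightarrow> complex set" where
  "lp_spectrum p T =
     {z. \<not> (\<exists>R. lp_bounded_operator p R \<and>
            (\<forall>x\<in>lp p. R (scalar_minus z T x) = x \<and> scalar_minus z T (R x) = x))}"

definition lp_quasinilpotent :: "real \<Rightarrow> ((nat \<Rightarrow> complex) \<Rightarrow> (nat \<Rightarrow> complex)) \<Rightarrow> bool" where
  "lp_quasinilpotent p T \<longleftrightarrow> lp_bounded_operator p T \<and> lp_spectrum p T = {0}"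

text \<open>The inverse of \<open>z - T\<close> on the space; meaningful for \<open>z\<close> outside the spectrum.\<close>

definition lp_resolvent ::
    "real \<Rightarrow> ((nat \<Rightarrow> complex) \<Rightarrow> (nat \<Rightarrow> complex)) \<Rightarrow> complex \<Rightarrow> (nat \<Rightarrow> complex) \<Rightarrow> (nat \<Rightarrow> complex)" where
  "lp_resolvent p T z = inv_into (lp p) (scalar_minus z T)"

text \<open>
  The next two notions are meant for quasinilpotent \<open>T\<close>. The upper limit over punctured
  neighbourhoods of 0 is taken in the extended reals, so that it exists without further
  assumptions.
\<close>

definition lp_local_exponent ::
    "real \<Rightarrow> ((nat \<Rightarrow> complex) \<Rightarrow> (nat \<Rightarrow> complex)) \<Rightarrow> (nat \<Rightarrow> complex) \<Rightarrow> ereal" where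
  "lp_local_exponent p T x =
     Limsup (at 0) (\<lambda>z::complex.
       ereal (ln (lp_norm p (lp_resolvent p T z x)) / ln (lp_opnorm p (lp_resolvent p T z))))"

definition lp_power_set :: "real \<Rightarrow> ((nat \<Rightarrow> complex) \<Rightarrow> (nat \<Rightarrow> complex)) \<Rightarrow> ereal set" where
  "lp_power_set p T = lp_local_exponent p T ` (lp p - {\<lambda>n. 0})"


section \<open>Backward weighted shifts\<close>

definition backward_shift :: "(nat \<Rightarrow> complex) \<Rightarrow> (nat \<Rightarrow> complex) \<Rightarrow> (nat \<Rightarrow> complex)" where
  "backward_shift w x = (\<lambda>n. w n * x (Suc n))"

lemma backward_shift_unit_seq_0: "backward_shift w (unit_seq 0) = (\<lambda>n. 0)"
  by (auto simp: backward_shift_def unit_seq_def)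

lemma backward_shift_unit_seq_Suc:
  "backward_shift w (unit_seq (Suc m)) = (\<lambda>n. w m * unit_seq m n)"
  by (auto simp: backward_shift_def unit_seq_def)

abbreviation harmonic_shift :: "(nat \<Rightarrow> complex) \<Rightarrow> (nat \<Rightarrow> complex)" where
  "harmonic_shift \<equiv> backward_shift (\<lambda>n. 1 / (of_nat n + 1))"


section \<open>The shift with weights \<open>1 / (n + 1)\<close> is quasinilpotent\<close>

lemma powr_above_tangent:
  fixes s t p :: real
  assumes "1 \<le> p" "0 \<le> s" "0 \<le> t"
  shows "s powr p + p * s powr (p - 1) * (t - s) \<le> t powr p"
proof (cases "s = 0 \<or> t = 0")
  case True
  have eq: "s powr (p - 1) * s = s powr p" if "s > 0"
    using that by (simp add: powr_diff)
  show ?thesis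
  proof (cases "s = 0")
    case False
    then have "t = 0" "s > 0" using True assms by auto
    then have "s powr p + p * s powr (p - 1) * (t - s) = s powr p * (1 - p)"
      using eq by (simp add: algebra_simps)
    also have "\<dots> \<le> 0" using assms by (simp add: mult_nonneg_nonpos)
    finally show ?thesis using \<open>t = 0\<close> by simp
  qed simp
next
  case False
  then have st: "s > 0" "t > 0" using assms by auto
  have "t powr p - s powr p \<ge> (p * s powr (p - 1)) * (t - s)"
  proof (rule convex_on_imp_above_tangent[where A = "{0<..}"])
    show "convex_on {0<..} (\<lambda>x. x powr p)" using powr_convex assms by blast
    show "((\<lambda>x. x powr p) has_field_derivative p * s powr (p - 1)) (at s within {0<..})"
      using st by (auto intro!: derivative_eq_intros)
  qed (use st in \<open>auto simp: interior_open\<close>)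
  then show ?thesis by linarith
qed

lemma suminf_powr_le:
  fixes a u :: "nat \<Rightarrow> real" and p :: real
  assumes p: "1 \<le> p" and a: "\<And>k. 0 \<le> a k" and u: "\<And>k. 0 \<le> u k"
    and sa: "summable a" and Apos: "0 < suminf a"
    and su: "summable (\<lambda>k. a k * u k)" and sp: "summable (\<lambda>k. a k * u k powr p)"
  shows "(\<Sum>k. a k * u k) powr p \<le> suminf a powr (p - 1) * (\<Sum>k. a k * u k powr p)"
proof -
  define A where "A = suminf a"
  define U where "U = (\<Sum>k. a k * u k)"
  define m where "m = U / A"
  have A: "A > 0" using Apos by (simp add: A_def)
  have U0: "U \<ge> 0" unfolding U_def using su a u by (intro suminf_nonneg) auto
  have m: "m \<ge> 0" using A U0 by (simp add: m_def)
  have "(\<lambda>k. a k * (m powr p + p * m powr (p - 1) * (u k - m))) sums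
        (A * (m powr p - p * m powr (p - 1) * m) + p * m powr (p - 1) * U)"
  proof -
    have 1: "a sums A" and 2: "(\<lambda>k. a k * u k) sums U"
      using sa su by (auto simp: A_def U_def summable_sums)
    show ?thesis
      using sums_add[OF sums_mult2[OF 1, of "m powr p - p * m powr (p - 1) * m"]
          sums_mult[OF 2, of "p * m powr (p - 1)"]]
      by (simp add: algebra_simps)
  qed
  moreover have "(\<lambda>k. a k * u k powr p) sums (\<Sum>k. a k * u k powr p)"
    using sp by (rule summable_sums)
  ultimately have "A * (m powr p - p * m powr (p - 1) * m) + p * m powr (p - 1) * U
      \<le> (\<Sum>k. a k * u k powr p)"
    by (rule sums_le[rotated 1]) (intro mult_left_mono powr_above_tangent p m u a)
  moreover have "U = A * m" using A by (simp add: m_def)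
  ultimately have "A * m powr p \<le> (\<Sum>k. a k * u k powr p)"
    by (simp add: algebra_simps)
  then have "A powr (p - 1) * (A * m powr p) \<le> A powr (p - 1) * (\<Sum>k. a k * u k powr p)"
    by (intro mult_left_mono) auto
  moreover have "A powr (p - 1) * (A * m powr p) = U powr p"
  proof -
    have "A powr (p - 1) * A = A powr p" using A by (simp add: powr_diff)
    moreover have "U powr p = A powr p * m powr p"
      using \<open>U = A * m\<close> A m by (simp add: powr_mult)
    ultimately show ?thesis by (simp add: mult.assoc[symmetric])
  qed
  ultimately show ?thesis by (simp add: A_def U_def)
qed

lemma cmod_powr_le_suminf:
  assumes "x \<in> lp p"
  shows "cmod (x n) powr p \<le> (\<Sum>n. cmod (x n) powr p)"
  using assms sum_le_suminf[of "\<lambda>n. cmod (x n) powr p" "{n}"] by (auto simp: lp_def)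

lemma cmod_le_lp_norm:
  assumes "x \<in> lp p" "1 \<le> p"
  shows "cmod (x n) \<le> lp_norm p x"
proof -
  have "cmod (x n) = (cmod (x n) powr p) powr (1 / p)"
    using assms by (simp add: powr_powr)
  also have "\<dots> \<le> lp_norm p x"
    unfolding lp_norm_def using assms cmod_powr_le_suminf[OF assms(1)]
    by (intro powr_mono2) auto
  finally show ?thesis .
qed

lemma lp_norm_leI:
  assumes p: "1 \<le> p" and C: "0 \<le> C" and x: "x \<in> lp p"
    and le: "\<And>N. (\<Sum>n<N. cmod (y n) powr p) \<le> C powr p * (\<Sum>n. cmod (x n) powr p)"
  shows "y \<in> lp p" "lp_norm p y \<le> C * lp_norm p x"
proof -
  show y: "y \<in> lp p" unfolding lp_def mem_Collect_eq
    using le by (intro summableI_nonneg_bounded) auto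
  have nn: "0 \<le> (\<Sum>n. cmod (x n) powr p)" "0 \<le> (\<Sum>n. cmod (y n) powr p)"
    using x y by (auto simp: lp_def intro!: suminf_nonneg)
  have "(\<Sum>n. cmod (y n) powr p) \<le> C powr p * (\<Sum>n. cmod (x n) powr p)"
    using y le by (intro suminf_le_const) (auto simp: lp_def)
  then have "lp_norm p y \<le> (C powr p * (\<Sum>n. cmod (x n) powr p)) powr (1 / p)"
    unfolding lp_norm_def using p nn by (intro powr_mono2) auto
  also have "\<dots> = C * lp_norm p x"
    using p C nn by (simp add: powr_mult powr_powr lp_norm_def)
  finally show "lp_norm p y \<le> C * lp_norm p x" .
qed

lemma harmonic_shift_bounded:
  assumes "1 \<le> p"
  shows "lp_bounded_operator p harmonic_shift"
proof -
  have le: "cmod (harmonic_shift x n) \<le> cmod (x (Suc n))" for x n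
  proof -
    have "cmod (of_nat n + 1) = real n + 1"
      by (metis norm_of_nat of_nat_1 of_nat_add)
    then show ?thesis
      by (simp add: backward_shift_def norm_divide divide_le_eq algebra_simps)
  qed
  have sum_le: "(\<Sum>n<N. cmod (harmonic_shift x n) powr p) \<le> 1 powr p * (\<Sum>n. cmod (x n) powr p)"
    if x: "x \<in> lp p" for x N
  proof -
    have s: "summable (\<lambda>n. cmod (x n) powr p)" using x by (simp add: lp_def)
    have "(\<Sum>n<N. cmod (harmonic_shift x n) powr p) \<le> (\<Sum>n<N. cmod (x (Suc n)) powr p)"
      using assms le by (intro sum_mono powr_mono2) auto
    also have "\<dots> \<le> (\<Sum>n. cmod (x (Suc n)) powr p)"
      using s by (intro sum_le_suminf) (auto simp: summable_Suc_iff[of "\<lambda>n. cmod (x n) powr p"])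
    also have "\<dots> \<le> (\<Sum>n. cmod (x n) powr p)"
      using suminf_split_head[OF s] by simp
    finally show ?thesis by simp
  qed
  have "\<forall>x\<in>lp p. lp_norm p (harmonic_shift x) \<le> 1 * lp_norm p x"
    using lp_norm_leI(2)[OF assms, of 1] sum_le by simp
  then have "\<exists>C. \<forall>x\<in>lp p. lp_norm p (harmonic_shift x) \<le> C * lp_norm p x"
    by (rule exI)
  moreover have "\<forall>x\<in>lp p. harmonic_shift x \<in> lp p"
    using lp_norm_leI(1)[OF assms, of 1] sum_le by simp
  ultimately show ?thesis
    unfolding lp_bounded_operator_def
    by (auto simp: backward_shift_def algebra_simps add_divide_distrib)
qed

text \<open>The Neumann series of the resolvent, coordinatewise.\<close>

definition harmonic_resolvent :: "complex \<Rightarrow> (nat \<Rightarrow> complex) \<Rightarrow> (nat \<Rightarrow> complex)" where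
  "harmonic_resolvent z x =
     (\<lambda>n. \<Sum>k. (fact n / fact (n + k)) * inverse z ^ Suc k * x (n + k))"

context
  fixes z :: complex and p :: real
  assumes z: "z \<noteq> 0" and p: "1 \<le> p"
begin

definition res_coeff :: "nat \<Rightarrow> real" where
  "res_coeff k = inverse (cmod z) * (inverse (fact k) * inverse (cmod z) ^ k)"

lemma res_coeff_nonneg: "0 \<le> res_coeff k"
  by (simp add: res_coeff_def)

lemma summable_res_coeff: "summable res_coeff"
  unfolding res_coeff_def by (intro summable_mult summable_exp)

lemma suminf_res_coeff_pos: "0 < suminf res_coeff"
  using z by (intro suminf_pos summable_res_coeff) (auto simp: res_coeff_def)

lemma fact_quotient_le: "(fact n :: real) / fact (n + k) \<le> inverse (fact k)"
proof -
  have "fact n * fact k \<le> (fact (n + k) :: nat)"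
    by (intro dvd_imp_le fact_fact_dvd_fact) simp
  then have "real (fact n * fact k) \<le> real (fact (n + k))"
    by (rule of_nat_mono)
  then show ?thesis by (simp add: field_simps)
qed

lemma res_term_le:
  "cmod ((fact n / fact (n + k)) * inverse z ^ Suc k * x (n + k)) \<le> res_coeff k * cmod (x (n + k))"
proof -
  have "cmod ((fact n / fact (n + k)) * inverse z ^ Suc k * x (n + k)) =
        (fact n / fact (n + k)) * (inverse (cmod z) ^ Suc k * cmod (x (n + k)))"
    by (simp add: norm_mult norm_divide norm_power norm_inverse)
  also have "\<dots> \<le> inverse (fact k) * (inverse (cmod z) ^ Suc k * cmod (x (n + k)))"
    by (intro mult_right_mono fact_quotient_le) auto
  finally show ?thesis by (simp add: res_coeff_def mult_ac)
qed

lemma summable_res_bound: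
  assumes "x \<in> lp p"
  shows "summable (\<lambda>k. res_coeff k * cmod (x (n + k)))"
  by (rule summable_comparison_test'[OF summable_mult2[OF summable_res_coeff, of "lp_norm p x"]])
     (auto simp: res_coeff_nonneg abs_mult intro!: mult_left_mono cmod_le_lp_norm assms p)

lemma summable_res_bound_powr:
  assumes "x \<in> lp p"
  shows "summable (\<lambda>k. res_coeff k * cmod (x (n + k)) powr p)"
  by (rule summable_comparison_test'[OF summable_mult2[OF summable_res_coeff,
        of "\<Sum>n. cmod (x n) powr p"]])
     (auto simp: res_coeff_nonneg abs_mult intro!: mult_left_mono cmod_powr_le_suminf assms)

lemma summable_res:
  assumes "x \<in> lp p"
  shows "summable (\<lambda>k. (fact n / fact (n + k)) * inverse z ^ Suc k * x (n + k))"
  by (rule summable_comparison_test'[OF summable_res_bound[OF assms, of n]]) (rule res_term_le)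

lemma harmonic_resolvent_sum_le:
  assumes x: "x \<in> lp p"
  shows "(\<Sum>n<N. cmod (harmonic_resolvent z x n) powr p)
           \<le> suminf res_coeff powr p * (\<Sum>n. cmod (x n) powr p)"
proof -
  let ?A = "suminf res_coeff" and ?S = "\<Sum>n. cmod (x n) powr p"
  have s: "summable (\<lambda>n. cmod (x n) powr p)" using x by (simp add: lp_def)
  have "cmod (harmonic_resolvent z x n) powr p
          \<le> ?A powr (p - 1) * (\<Sum>k. res_coeff k * cmod (x (n + k)) powr p)" for n
  proof -
    have "cmod (harmonic_resolvent z x n) \<le> (\<Sum>k. res_coeff k * cmod (x (n + k)))"
    proof -
      let ?f = "\<lambda>k. (fact n / fact (n + k)) * inverse z ^ Suc k * x (n + k)"
      have sn: "summable (\<lambda>k. cmod (?f k))"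
        by (rule summable_comparison_test'[OF summable_res_bound[OF x, of n]])
           (use res_term_le in simp)
      have "cmod (suminf ?f) \<le> (\<Sum>k. cmod (?f k))"
        by (rule summable_norm[OF sn])
      also have "\<dots> \<le> (\<Sum>k. res_coeff k * cmod (x (n + k)))"
        by (intro suminf_le res_term_le sn summable_res_bound x)
      finally show ?thesis by (simp only: harmonic_resolvent_def)
    qed
    then have "cmod (harmonic_resolvent z x n) powr p \<le> (\<Sum>k. res_coeff k * cmod (x (n + k))) powr p"
      using p by (intro powr_mono2) auto
    also have "\<dots> \<le> ?A powr (p - 1) * (\<Sum>k. res_coeff k * cmod (x (n + k)) powr p)"
      by (intro suminf_powr_le p res_coeff_nonneg summable_res_coeff suminf_res_coeff_pos
          summable_res_bound summable_res_bound_powr x) auto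
    finally show ?thesis .
  qed
  then have "(\<Sum>n<N. cmod (harmonic_resolvent z x n) powr p)
      \<le> (\<Sum>n<N. ?A powr (p - 1) * (\<Sum>k. res_coeff k * cmod (x (n + k)) powr p))"
    by (intro sum_mono) auto
  also have "\<dots> = ?A powr (p - 1) * (\<Sum>n<N. \<Sum>k. res_coeff k * cmod (x (n + k)) powr p)"
    by (simp add: sum_distrib_left)
  also have "(\<Sum>n<N. \<Sum>k. res_coeff k * cmod (x (n + k)) powr p)
      = (\<Sum>k. \<Sum>n<N. res_coeff k * cmod (x (n + k)) powr p)"
    by (intro suminf_sum[symmetric] summable_res_bound_powr x)
  also have "\<dots> \<le> (\<Sum>k. res_coeff k * ?S)"
  proof (intro suminf_le summable_sum summable_res_bound_powr x summable_mult2 summable_res_coeff)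
    fix k
    have "(\<Sum>n<N. cmod (x (n + k)) powr p) = (\<Sum>n\<in>(\<lambda>n. n + k) ` {..<N}. cmod (x n) powr p)"
      by (simp add: sum.reindex)
    also have "\<dots> \<le> ?S" using s by (intro sum_le_suminf) auto
    finally show "(\<Sum>n<N. res_coeff k * cmod (x (n + k)) powr p) \<le> res_coeff k * ?S"
      by (simp add: sum_distrib_left[symmetric] mult_left_mono res_coeff_nonneg)
  qed
  also have "\<dots> = ?A * ?S"
    using summable_res_coeff by (simp add: suminf_mult2)
  finally have "(\<Sum>n<N. cmod (harmonic_resolvent z x n) powr p) \<le> ?A powr (p - 1) * (?A * ?S)"
    by (simp add: mult_left_mono)
  also have "?A powr (p - 1) * (?A * ?S) = ?A powr p * ?S"
    using suminf_res_coeff_pos by (simp add: powr_diff)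
  finally show ?thesis .
qed

lemma harmonic_resolvent_bounded: "lp_bounded_operator p (harmonic_resolvent z)"
proof -
  note * = lp_norm_leI[OF p less_imp_le[OF suminf_res_coeff_pos] _ harmonic_resolvent_sum_le]
  have add: "harmonic_resolvent z (\<lambda>n. x n + y n) =
      (\<lambda>n. harmonic_resolvent z x n + harmonic_resolvent z y n)" if "x \<in> lp p" "y \<in> lp p" for x y
    unfolding harmonic_resolvent_def
    using suminf_add[OF summable_res[OF that(1)] summable_res[OF that(2)]]
    by (simp add: ring_distribs)
  have scale: "harmonic_resolvent z (\<lambda>n. c * x n) = (\<lambda>n. c * harmonic_resolvent z x n)"
    if "x \<in> lp p" for c x
    unfolding harmonic_resolvent_def
    using suminf_mult[OF summable_res[OF that], of c] by (simp add: mult_ac)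
  show ?thesis
    unfolding lp_bounded_operator_def using * add scale by blast
qed

lemma harmonic_resolvent_left:
  assumes x: "x \<in> lp p"
  shows "harmonic_resolvent z (scalar_minus z harmonic_shift x) = x"
proof
  fix n
  define b where "b k = (fact n / fact (n + k)) * inverse z ^ k * x (n + k)" for k
  have "(\<lambda>k. z * ((fact n / fact (n + k)) * inverse z ^ Suc k * x (n + k))) = b"
    using z by (auto simp: b_def field_simps)
  then have "summable b"
    using summable_mult[OF summable_res[OF x, of n], of z] by simp
  then have "b \<longlonglongrightarrow> 0" by (rule summable_LIMSEQ_zero)
  then have "(\<lambda>k. b k - b (Suc k)) sums (b 0 - 0)" by (rule telescope_sums')
  moreover have "b k - b (Suc k) = (fact n / fact (n + k)) * inverse z ^ Suc k *
        scalar_minus z harmonic_shift x (n + k)" for k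
  proof -
    have f: "(fact (n + Suc k) :: complex) = (of_nat (n + k) + 1) * fact (n + k)"
      by simp
    have "b k = (fact n / fact (n + k)) * inverse z ^ Suc k * (z * x (n + k))"
      using z by (simp add: b_def)
    moreover have "b (Suc k) = (fact n / fact (n + k)) * inverse z ^ Suc k *
        (1 / (of_nat (n + k) + 1) * x (Suc (n + k)))"
      unfolding b_def f by (simp del: of_nat_add)
    ultimately show ?thesis
      by (simp only: scalar_minus_def backward_shift_def right_diff_distrib)
  qed
  ultimately show "harmonic_resolvent z (scalar_minus z harmonic_shift x) n = x n"
    by (simp add: harmonic_resolvent_def sums_iff b_def)
qed

lemma harmonic_resolvent_right:
  assumes x: "x \<in> lp p"
  shows "scalar_minus z harmonic_shift (harmonic_resolvent z x) = x"
proof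
  fix n
  define t where "t m k = (fact m / fact (m + k)) * inverse z ^ Suc k * x (m + k)" for m k
  have st: "summable (t m)" for m unfolding t_def by (rule summable_res[OF x])
  have nz: "(1 + of_nat n :: complex) \<noteq> 0"
    by (metis of_nat_Suc of_nat_eq_0_iff nat.distinct(1))
  have step: "z * t n (Suc k) = 1 / (of_nat n + 1) * t (Suc n) k" for k
  proof -
    have f: "(fact (Suc n) :: complex) = (of_nat n + 1) * fact n"
      by simp
    show ?thesis
      using z nz unfolding t_def f by (simp add: add.commute del: fact_Suc)
  qed
  have "z * suminf (t n) = z * t n 0 + (\<Sum>k. z * t n (Suc k))"
  proof -
    have "summable (\<lambda>k. t n (Suc k))"
      using st[of n] by (simp add: summable_Suc_iff)
    then have "(\<Sum>k. z * t n (Suc k)) = z * (\<Sum>k. t n (Suc k))"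
      by (rule suminf_mult)
    then show ?thesis
      using suminf_split_head[OF st[of n]] by (simp add: algebra_simps)
  qed
  also have "(\<Sum>k. z * t n (Suc k)) = 1 / (of_nat n + 1) * suminf (t (Suc n))"
    unfolding step by (rule suminf_mult[OF st])
  also have "z * t n 0 = x n" using z by (simp add: t_def)
  finally have "z * suminf (t n) - 1 / (of_nat n + 1) * suminf (t (Suc n)) = x n"
    by simp
  then show "scalar_minus z harmonic_shift (harmonic_resolvent z x) n = x n"
    by (simp add: scalar_minus_def backward_shift_def harmonic_resolvent_def t_def[abs_def])
qed

end

theorem harmonic_shift_quasinilpotent:
  assumes p: "1 \<le> p"
  shows "lp_quasinilpotent p harmonic_shift"
proof -
  have "z \<notin> lp_spectrum p harmonic_shift" if "z \<noteq> 0" for z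
    unfolding lp_spectrum_def
    using harmonic_resolvent_bounded[OF that p] harmonic_resolvent_left[OF that p]
      harmonic_resolvent_right[OF that p] by auto
  moreover have "0 \<in> lp_spectrum p harmonic_shift"
  proof -
    have mem: "unit_seq 0 \<in> lp p" "(\<lambda>n. 0) \<in> lp p"
      by (auto simp: lp_def unit_seq_def intro!: summable_finite[of "{0}"] split: if_splits)
    have eq: "scalar_minus 0 harmonic_shift (unit_seq 0) = scalar_minus 0 harmonic_shift (\<lambda>n. 0)"
      by (auto simp: scalar_minus_def backward_shift_def unit_seq_def)
    have ne: "unit_seq 0 \<noteq> (\<lambda>n. 0)"
      by (auto simp: unit_seq_def fun_eq_iff)
    show ?thesis
      unfolding lp_spectrum_def using mem eq ne by (auto; metis)
  qed
  ultimately show ?thesis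
    unfolding lp_quasinilpotent_def using harmonic_shift_bounded[OF p] by auto
qed

end

theory Submission
  imports Defs "HOL-Real_Asymp.Real_Asymp"
begin

text \<open>
  Write \<open>T\<close> for the shift, \<open>R z\<close> for its resolvent and \<open>r = 1 / \<bar>z\<bar>\<close>. The Neumann series reads
  \<open>(R z x) n = (\<Sum>k. (n! / (n + k)!) * z powi (- k - 1) * x (n + k))\<close>, and \<open>n! / (n + k)! \<le> 1 / k!\<close>, so
  that \<open>\<parallel>R z\<parallel> \<le> r * exp r\<close>. The bound is attained up to polynomial factors in \<open>r\<close>: if the coordinates of
  a vector of fixed norm have phases cancelling those of \<open>z powi (- k)\<close> and decay only polynomially, then
  coordinate \<open>0\<close> of its image is a power series in \<open>r\<close> that grows like \<open>exp r\<close>. Hence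
  \<open>ln \<parallel>R z\<parallel> \<sim> r\<close> (\<open>ln_lp_opnorm_resolvent_tendsto\<close>), and
  the local exponent of \<open>x\<close> is the upper limit of \<open>\<bar>z\<bar> * ln \<parallel>R z x\<parallel>\<close>: it measures the exponential type
  of \<open>R z x\<close> as an entire function of \<open>1 / z\<close>.

  Every exponent is at most \<open>1\<close> because of the norm bound, and at least \<open>0\<close> because
  \<open>x = (z - T) (R z x)\<close> with \<open>z - T\<close> bounded near \<open>0\<close>. Conversely, on the geometric sequence
  \<open>x n = a ^ n\<close> with \<open>0 \<le> a < 1\<close> the resolvent multiplies every coordinate by a number of modulus at
  most \<open>r * exp (a * r)\<close>, with equality at coordinate \<open>0\<close> for \<open>z > 0\<close>, so its exponent is \<open>a\<close>; the case
  \<open>a = 0\<close> is the kernel vector \<open>unit_seq 0\<close>. The value \<open>1\<close> would need \<open>a = 1\<close>, which leaves the space,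
  but a polynomially damped constant sequence has the same exponential type.
\<close>


section \<open>The norm of the sequence space\<close>

lemma zero_in_lp: "(\<lambda>n. 0) \<in> lp p"
  by (simp add: lp_def)

lemma lp_norm_scale:
  assumes "1 \<le> p" "x \<in> lp p" "0 \<le> c"
  shows "lp_norm p (\<lambda>n. of_real c * x n) = c * lp_norm p x"
proof -
  have s: "summable (\<lambda>n. cmod (x n) powr p)" using assms by (simp add: lp_def)
  have "(\<Sum>n. cmod (of_real c * x n) powr p) = c powr p * (\<Sum>n. cmod (x n) powr p)"
    using suminf_mult[OF s, of "c powr p"] assms by (simp add: norm_mult powr_mult)
  moreover have "0 \<le> (\<Sum>n. cmod (x n) powr p)"
    using s by (intro suminf_nonneg) auto
  ultimately show ?thesis
    using assms by (simp add: lp_norm_def powr_mult powr_powr)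
qed

lemma lp_norm_pos:
  assumes "1 \<le> p" "x \<in> lp p" "x \<noteq> (\<lambda>n. 0)"
  shows "0 < lp_norm p x"
proof -
  obtain n where "x n \<noteq> 0" using assms(3) by auto
  then show ?thesis
    using cmod_le_lp_norm[OF assms(2,1), of n] by (meson less_le_trans zero_less_norm_iff)
qed


section \<open>The resolvent\<close>

lemma lp_resolvent_eq_harmonic_resolvent:
  assumes "z \<noteq> 0" "1 \<le> p" "x \<in> lp p"
  shows "lp_resolvent p harmonic_shift z x = harmonic_resolvent z x"
  unfolding lp_resolvent_def
proof (rule inv_into_f_eq)
  show "inj_on (scalar_minus z harmonic_shift) (lp p)"
    by (rule inj_on_inverseI) (rule harmonic_resolvent_left[OF assms(1,2)])
  show "harmonic_resolvent z x \<in> lp p"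
    using harmonic_resolvent_bounded[OF assms(1,2)] assms(3)
    by (auto simp: lp_bounded_operator_def)
  show "scalar_minus z harmonic_shift (harmonic_resolvent z x) = x"
    by (rule harmonic_resolvent_right[OF assms])
qed

lemma harmonic_resolvent_in_lp:
  assumes "z \<noteq> 0" "1 \<le> p" "x \<in> lp p"
  shows "harmonic_resolvent z x \<in> lp p"
  using harmonic_resolvent_bounded[OF assms(1,2)] assms(3)
  by (auto simp: lp_bounded_operator_def)

lemma harmonic_resolvent_0_sums:
  assumes "z \<noteq> 0" "1 \<le> p" "x \<in> lp p"
  shows "(\<lambda>k. inverse z ^ k * x k / fact k) sums (z * harmonic_resolvent z x 0)"
proof -
  have "(\<lambda>k. (fact 0 / fact (0 + k)) * inverse z ^ Suc k * x (0 + k)) sums harmonic_resolvent z x 0"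
    using summable_res[OF assms, of 0] by (simp only: harmonic_resolvent_def summable_sums)
  from sums_mult[OF this, of z] show ?thesis
    using assms(1) by (simp add: field_simps)
qed

lemma res_coeff_geometric_sums:
  assumes "z \<noteq> 0"
  shows "(\<lambda>k. res_coeff z k * a ^ k) sums (exp (a / cmod z) / cmod z)"
proof -
  have "(\<lambda>k. (inverse (cmod z) * a) ^ k /\<^sub>R fact k) sums exp (inverse (cmod z) * a)"
    by (rule exp_converges)
  from sums_mult[OF this, of "inverse (cmod z)"] show ?thesis
    by (simp add: res_coeff_def[OF assms order_refl] power_mult_distrib divide_inverse mult_ac)
qed

lemma suminf_res_coeff:
  assumes "z \<noteq> 0"
  shows "suminf (res_coeff z) = exp (1 / cmod z) / cmod z"
  using res_coeff_geometric_sums[OF assms, of 1] by (simp add: sums_iff)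

lemma lp_norm_harmonic_resolvent_le:
  assumes "z \<noteq> 0" "1 \<le> p" "x \<in> lp p"
  shows "lp_norm p (harmonic_resolvent z x) \<le> exp (1 / cmod z) / cmod z * lp_norm p x"
  using lp_norm_leI(2)[OF assms(2) _ assms(3) harmonic_resolvent_sum_le[OF assms]]
    suminf_res_coeff_pos[OF assms(1,2)]
  by (simp add: suminf_res_coeff[OF assms(1)])

text \<open>
  This is a form of \<open>\<parallel>x\<parallel> \<le> (\<bar>z\<bar> + \<parallel>T\<parallel>) * \<parallel>R z x\<parallel>\<close>. Reading it off one coordinate at a time
  replaces Minkowski's inequality by the triangle inequality for complex numbers.
\<close>

lemma cmod_le_lp_norm_harmonic_resolvent:
  assumes z: "z \<noteq> 0" and p: "1 \<le> p" and x: "x \<in> lp p"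
  shows "cmod (x n) \<le> (cmod z + 1) * lp_norm p (harmonic_resolvent z x)"
proof -
  define y where "y = harmonic_resolvent z x"
  have y: "y \<in> lp p"
    unfolding y_def by (rule harmonic_resolvent_in_lp[OF assms])
  have "x n = z * y n - 1 / (of_nat n + 1) * y (Suc n)"
    using harmonic_resolvent_right[OF assms, THEN fun_cong, of n]
    by (simp add: y_def scalar_minus_def backward_shift_def)
  also have "cmod \<dots> \<le> cmod z * cmod (y n) + cmod (1 / (of_nat n + 1)) * cmod (y (Suc n))"
    by (metis norm_mult norm_triangle_ineq4)
  also have "\<dots> \<le> cmod z * lp_norm p y + 1 * lp_norm p y"
  proof (intro add_mono mult_mono cmod_le_lp_norm y p)
    have "cmod (of_nat n + 1) = real n + 1"
      by (metis norm_of_nat of_nat_1 of_nat_add)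
    then show "cmod (1 / (of_nat n + 1)) \<le> 1"
      by (simp add: norm_divide)
  qed auto
  finally show ?thesis by (simp add: y_def algebra_simps)
qed

lemma lp_norm_harmonic_resolvent_pos:
  assumes "z \<noteq> 0" "1 \<le> p" "x \<in> lp p" "x \<noteq> (\<lambda>n. 0)"
  shows "0 < lp_norm p (harmonic_resolvent z x)"
proof -
  obtain n where "x n \<noteq> 0" using assms(4) by auto
  then have "0 < (cmod z + 1) * lp_norm p (harmonic_resolvent z x)"
    using cmod_le_lp_norm_harmonic_resolvent[OF assms(1-3), of n]
    by (meson less_le_trans zero_less_norm_iff)
  then show ?thesis
    by (rule zero_less_mult_pos) (simp add: add_nonneg_pos)
qed


section \<open>The norm of the resolvent\<close>

text \<open>
  The weights \<open>1 / ((n + 1) * (n + 2))\<close> make the sequence summable for unimodular \<open>u\<close>, and they turn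
  \<open>1 / n!\<close> into \<open>1 / (n + 2)!\<close>, so that coordinate \<open>0\<close> of the resolvent is a shifted exponential
  series with a closed form.
\<close>

definition damped_powers :: "complex \<Rightarrow> nat \<Rightarrow> complex" where
  "damped_powers u n = u ^ n / ((of_nat n + 1) * (of_nat n + 2))"

lemma cmod_damped_powers:
  assumes "cmod u = 1"
  shows "cmod (damped_powers u n) = 1 / ((real n + 1) * (real n + 2))"
proof -
  have "cmod (of_nat n + 1) = real n + 1" "cmod (of_nat n + 2) = real n + 2"
    by (metis norm_of_nat of_nat_1 of_nat_add) (metis norm_of_nat of_nat_numeral of_nat_add)
  then show ?thesis
    by (simp add: damped_powers_def norm_divide norm_mult norm_power assms)
qed

lemma damped_powers_in_lp:
  assumes "cmod u = 1" "1 \<le> p"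
  shows "damped_powers u \<in> lp p"
proof -
  have "(\<lambda>n. 1 / (real n + 1)) \<longlonglongrightarrow> 0" by real_asymp
  from telescope_sums'[OF this]
  have s: "summable (\<lambda>n. 1 / ((real n + 1) * (real n + 2)))"
    by (simp add: field_simps sums_iff)
  have "cmod (damped_powers u n) powr p \<le> 1 / ((real n + 1) * (real n + 2))" for n
  proof -
    have "1 / ((real n + 1) * (real n + 2)) \<le> 1" by (simp add: divide_simps algebra_simps)
    then have "(1 / ((real n + 1) * (real n + 2))) powr p \<le> (1 / ((real n + 1) * (real n + 2))) powr 1"
      using assms(2) by (intro powr_mono') auto
    then show ?thesis by (simp add: cmod_damped_powers[OF assms(1)])
  qed
  then show ?thesis
    unfolding lp_def mem_Collect_eq by (intro summable_comparison_test'[OF s, of 0]) simp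
qed

lemma damped_powers_nonzero: "damped_powers u \<noteq> (\<lambda>n. 0)"
  by (auto simp: fun_eq_iff damped_powers_def intro!: exI[of _ 0])

text \<open>
  The choice \<open>u = sgn z\<close> makes all terms \<open>inverse z ^ k * u ^ k = (1 / \<bar>z\<bar>) ^ k\<close> positive, so nothing
  cancels at coordinate \<open>0\<close>.
\<close>

lemma lp_norm_resolvent_damped_powers_ge:
  assumes z: "z \<noteq> 0" and p: "1 \<le> p"
  shows "(exp (1 / cmod z) - 1 - 1 / cmod z) * cmod z
           \<le> lp_norm p (harmonic_resolvent z (damped_powers (sgn z)))"
proof -
  define r where "r = 1 / cmod z"
  have r: "r > 0" using z by (simp add: r_def)
  have u: "cmod (sgn z) = 1" using z by (simp add: norm_sgn)
  note x = damped_powers_in_lp[OF u p]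
  have "(\<lambda>k. r ^ (k + 2) / fact (k + 2)) sums (exp r - (\<Sum>i<2. r ^ i / fact i))"
    using sums_split_initial_segment[OF exp_converges[of r], of 2]
    by (simp add: divide_inverse mult.commute)
  from sums_divide[OF this, of "r^2"]
  have "(\<lambda>k. r ^ k / fact (k + 2)) sums ((exp r - 1 - r) / r^2)"
    using r by (simp add: numeral_2_eq_2 power_add diff_diff_eq del: fact_Suc)
  then have 1: "(\<lambda>k. complex_of_real (r ^ k / fact (k + 2))) sums of_real ((exp r - 1 - r) / r^2)"
    by (rule sums_of_real)
  have eq: "inverse z ^ k * damped_powers (sgn z) k / fact k = complex_of_real (r ^ k / fact (k + 2))" for k
  proof -
    have "inverse z * sgn z = of_real r"
      using z by (simp add: sgn_div_norm r_def scaleR_conv_of_real divide_inverse)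
    then have "inverse z ^ k * sgn z ^ k = of_real r ^ k"
      by (metis power_mult_distrib)
    moreover have "(fact (k + 2) :: complex) = (of_nat k + 1) * (of_nat k + 2) * fact k"
      by (simp add: algebra_simps)
    ultimately show ?thesis
      by (simp add: damped_powers_def del: fact_Suc)
  qed
  have "z * harmonic_resolvent z (damped_powers (sgn z)) 0 = of_real ((exp r - 1 - r) / r^2)"
    using harmonic_resolvent_0_sums[OF z p x] 1 unfolding eq by (rule sums_unique2)
  then have "cmod z * cmod (harmonic_resolvent z (damped_powers (sgn z)) 0) = \<bar>(exp r - 1 - r) / r^2\<bar>"
    by (metis norm_mult norm_of_real)
  then have "(exp r - 1 - r) / r^2 * r \<le> cmod (harmonic_resolvent z (damped_powers (sgn z)) 0)"
    using z by (simp add: r_def field_simps)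
  also have "\<dots> \<le> lp_norm p (harmonic_resolvent z (damped_powers (sgn z)))"
    by (rule cmod_le_lp_norm[OF harmonic_resolvent_in_lp[OF z p x] p])
  also have "(exp r - 1 - r) / r^2 * r = (exp r - 1 - r) * cmod z"
    using z by (simp add: r_def power2_eq_square)
  finally show ?thesis
    by (simp add: r_def)
qed

lemma lp_norm_resolvent_le_on_unit_ball:
  assumes z: "z \<noteq> 0" and p: "1 \<le> p" and x: "x \<in> lp p" "lp_norm p x \<le> 1"
  shows "lp_norm p (lp_resolvent p harmonic_shift z x) \<le> exp (1 / cmod z) / cmod z"
proof -
  have "lp_norm p (harmonic_resolvent z x) \<le> exp (1 / cmod z) / cmod z * lp_norm p x"
    by (rule lp_norm_harmonic_resolvent_le[OF z p x(1)])
  also have "\<dots> \<le> exp (1 / cmod z) / cmod z * 1"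
    using x by (intro mult_left_mono) auto
  finally show ?thesis
    by (simp add: lp_resolvent_eq_harmonic_resolvent[OF z p x(1)])
qed

lemma lp_opnorm_resolvent_le:
  assumes z: "z \<noteq> 0" and p: "1 \<le> p"
  shows "lp_opnorm p (lp_resolvent p harmonic_shift z) \<le> exp (1 / cmod z) / cmod z"
  unfolding lp_opnorm_def
proof (rule cSUP_least)
  show "{x \<in> lp p. lp_norm p x \<le> 1} \<noteq> {}"
    using zero_in_lp[of p] by (auto simp: lp_norm_def intro!: exI[of _ "\<lambda>n. 0"])
next
  show "lp_norm p (lp_resolvent p harmonic_shift z x) \<le> exp (1 / cmod z) / cmod z"
    if "x \<in> {x \<in> lp p. lp_norm p x \<le> 1}" for x
    using lp_norm_resolvent_le_on_unit_ball[OF z p] that by simp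
qed

lemma lp_norm_resolvent_le_opnorm:
  assumes z: "z \<noteq> 0" and p: "1 \<le> p" and x: "x \<in> lp p" and pos: "0 < lp_norm p x"
  shows "lp_norm p (harmonic_resolvent z x)
           \<le> lp_opnorm p (lp_resolvent p harmonic_shift z) * lp_norm p x"
proof -
  define c where "c = inverse (lp_norm p x)"
  define y where "y = (\<lambda>n. of_real c * x n)"
  have c: "0 < c" using pos by (simp add: c_def)
  have y: "y \<in> lp p" "lp_norm p y = 1"
    using x summable_mult[of "\<lambda>n. cmod (x n) powr p" "c powr p"] pos lp_norm_scale[OF p x, of c] c
    by (auto simp: lp_def y_def norm_mult powr_mult c_def)
  have "bdd_above ((\<lambda>x. lp_norm p (lp_resolvent p harmonic_shift z x)) ` {x \<in> lp p. lp_norm p x \<le> 1})"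
    by (rule bdd_aboveI2) (use lp_norm_resolvent_le_on_unit_ball[OF z p] in auto)
  then have "lp_norm p (lp_resolvent p harmonic_shift z y) \<le> lp_opnorm p (lp_resolvent p harmonic_shift z)"
    unfolding lp_opnorm_def by (rule cSUP_upper[rotated]) (use y in auto)
  also have "lp_resolvent p harmonic_shift z y = (\<lambda>n. of_real c * harmonic_resolvent z x n)"
    using lp_resolvent_eq_harmonic_resolvent[OF z p y(1)] harmonic_resolvent_bounded[OF z p] x
    by (simp add: y_def lp_bounded_operator_def)
  also have "lp_norm p \<dots> = c * lp_norm p (harmonic_resolvent z x)"
    using c by (intro lp_norm_scale harmonic_resolvent_in_lp z p x) auto
  finally show ?thesis
    using pos by (simp add: c_def field_simps)
qed

lemma filterlim_norm_at_right_0: "filterlim cmod (at_right 0) (at 0)"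
  unfolding filterlim_at by (auto simp: eventually_at intro!: tendsto_norm_zero exI[of _ 1])

text \<open>
  The test vector for the lower bound varies with \<open>z\<close>, but only through its phases, so its norm is a
  constant that disappears after taking logarithms and multiplying by \<open>\<bar>z\<bar>\<close>.
\<close>

lemma ln_lp_opnorm_resolvent_tendsto:
  assumes p: "1 \<le> p"
  shows "((\<lambda>z. cmod z * ln (lp_opnorm p (lp_resolvent p harmonic_shift z))) \<longlongrightarrow> 1) (at 0)"
proof -
  define c where "c = lp_norm p (damped_powers 1)"
  have norm_eq: "lp_norm p (damped_powers u) = c" if "cmod u = 1" for u
    using that by (simp add: c_def lp_norm_def cmod_damped_powers)
  have c: "c > 0"
    unfolding c_def using p by (intro lp_norm_pos damped_powers_in_lp damped_powers_nonzero) auto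
  define h where "h t = (exp (1 / t) - 1 - 1 / t) * t / c" for t
  have lower: "h (cmod z) \<le> lp_opnorm p (lp_resolvent p harmonic_shift z)" if z: "z \<noteq> 0" for z
  proof -
    have u: "cmod (sgn z) = 1" using z by (simp add: norm_sgn)
    have "h (cmod z) * c \<le> lp_norm p (harmonic_resolvent z (damped_powers (sgn z)))"
      using lp_norm_resolvent_damped_powers_ge[OF z p] c by (simp add: h_def)
    also have "\<dots> \<le> lp_opnorm p (lp_resolvent p harmonic_shift z) * c"
      using lp_norm_resolvent_le_opnorm[OF z p damped_powers_in_lp[OF u p]] norm_eq[OF u] c by simp
    finally show ?thesis using c by simp
  qed
  have h_pos: "eventually (\<lambda>t. h t > 0) (at_right 0)"
    unfolding h_def using c by real_asymp
  then have ev: "eventually (\<lambda>z. h (cmod z) > 0 \<and> z \<noteq> 0) (at 0)"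
    using filterlim_norm_at_right_0
    by (intro eventually_conj) (auto simp: filterlim_iff eventually_at_filter)
  show ?thesis
  proof (rule tendsto_sandwich)
    show "((\<lambda>z. cmod z * ln (h (cmod z))) \<longlongrightarrow> 1) (at 0)"
    proof (rule filterlim_compose[OF _ filterlim_norm_at_right_0])
      show "((\<lambda>t. t * ln (h t)) \<longlongrightarrow> 1) (at_right 0)"
        unfolding h_def using c by real_asymp
    qed
    show "((\<lambda>z. cmod z * ln (exp (1 / cmod z) / cmod z)) \<longlongrightarrow> 1) (at 0)"
    proof (rule filterlim_compose[OF _ filterlim_norm_at_right_0])
      show "((\<lambda>t::real. t * ln (exp (1 / t) / t)) \<longlongrightarrow> 1) (at_right 0)"
        by real_asymp
    qed
    show "eventually (\<lambda>z. cmod z * ln (h (cmod z))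
        \<le> cmod z * ln (lp_opnorm p (lp_resolvent p harmonic_shift z))) (at 0)"
      using ev
    proof eventually_elim
      case (elim z)
      then show ?case using lower[of z] by (intro mult_left_mono ln_mono) auto
    qed
    show "eventually (\<lambda>z. cmod z * ln (lp_opnorm p (lp_resolvent p harmonic_shift z))
        \<le> cmod z * ln (exp (1 / cmod z) / cmod z)) (at 0)"
      using ev
    proof eventually_elim
      case (elim z)
      then show ?case using lower[of z] lp_opnorm_resolvent_le[OF _ p, of z]
        by (intro mult_left_mono ln_mono) auto
    qed
  qed
qed


section \<open>Comparison principles for the local exponent\<close>

text \<open>
  Both comparison principles multiply numerator and denominator of the quotient of logarithms by
  \<open>\<bar>z\<bar>\<close>; the denominator then tends to \<open>1\<close>. Since the exponent is an upper limit, an upper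
  bound must hold for all \<open>z\<close>, while a lower bound along the positive reals is enough.
\<close>

lemma lp_local_exponent_le:
  assumes p: "1 \<le> p" and x: "x \<in> lp p" "x \<noteq> (\<lambda>n. 0)" and C: "0 < C"
    and le: "\<And>z. z \<noteq> 0 \<Longrightarrow>
      lp_norm p (harmonic_resolvent z x) \<le> exp (a / cmod z) / cmod z * C"
  shows "lp_local_exponent p harmonic_shift x \<le> ereal a"
proof -
  let ?L = "\<lambda>z. ln (lp_opnorm p (lp_resolvent p harmonic_shift z))"
  let ?G = "\<lambda>z. cmod z * ln (exp (a / cmod z) / cmod z * C) / (cmod z * ?L z)"
  have "((\<lambda>z. cmod z * ln (exp (a / cmod z) / cmod z * C)) \<longlongrightarrow> a) (at 0)"
  proof (rule filterlim_compose[OF _ filterlim_norm_at_right_0])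
    have lim: "((\<lambda>t. a + t * ln (C / t)) \<longlongrightarrow> a) (at_right 0)"
      using C by real_asymp
    have "eventually (\<lambda>t. a + t * ln (C / t) = t * ln (exp (a / t) / t * C)) (at_right 0)"
      using eventually_at_right_less[of 0]
    proof eventually_elim
      case (elim t)
      then have "ln (exp (a / t) / t * C) = a / t + ln (C / t)"
        using C by (simp add: ln_mult ln_div)
      then show ?case using elim by (simp add: algebra_simps)
    qed
    then show "((\<lambda>t. t * ln (exp (a / t) / t * C)) \<longlongrightarrow> a) (at_right 0)"
      using lim by (rule Lim_transform_eventually[rotated])
  qed
  then have "(?G \<longlongrightarrow> a / 1) (at 0)"
    by (intro tendsto_divide ln_lp_opnorm_resolvent_tendsto[OF p]) auto
  then have G: "((\<lambda>z. ereal (?G z)) \<longlongrightarrow> ereal a) (at 0)"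
    by simp
  have "eventually (\<lambda>z. z \<noteq> 0 \<and> cmod z * ?L z > 0) (at 0)"
    using order_tendstoD(1)[OF ln_lp_opnorm_resolvent_tendsto[OF p], of 0]
    by (auto simp: eventually_at_filter intro: eventually_conj elim: eventually_mono)
  then have "eventually (\<lambda>z. ereal (ln (lp_norm p (lp_resolvent p harmonic_shift z x)) / ?L z) \<le> ereal (?G z)) (at 0)"
  proof eventually_elim
    case (elim z)
    have "ln (lp_norm p (harmonic_resolvent z x)) \<le> ln (exp (a / cmod z) / cmod z * C)"
      using elim le lp_norm_harmonic_resolvent_pos[OF _ p x] by (intro ln_mono) auto
    then show ?case
      using elim lp_resolvent_eq_harmonic_resolvent[OF _ p x(1), of z]
      by (auto simp: zero_less_mult_iff intro: divide_right_mono)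
  qed
  then have "lp_local_exponent p harmonic_shift x \<le> Limsup (at 0) (\<lambda>z. ereal (?G z))"
    unfolding lp_local_exponent_def by (rule Limsup_mono)
  also have "\<dots> = ereal a"
    by (rule lim_imp_Limsup[OF _ G]) simp
  finally show ?thesis .
qed

lemma lp_local_exponent_ge:
  fixes h :: "real \<Rightarrow> real"
  assumes p: "1 \<le> p" and x: "x \<in> lp p"
    and le: "eventually (\<lambda>t. 0 < h t \<and> h t \<le> lp_norm p (harmonic_resolvent (of_real t) x)) (at_right 0)"
    and lim: "((\<lambda>t. t * ln (h t)) \<longlongrightarrow> a) (at_right 0)"
  shows "ereal a \<le> lp_local_exponent p harmonic_shift x"
proof -
  let ?L = "\<lambda>z. ln (lp_opnorm p (lp_resolvent p harmonic_shift z))"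
  let ?f = "\<lambda>z. ereal (ln (lp_norm p (lp_resolvent p harmonic_shift z x)) / ?L z)"
  let ?G = "\<lambda>t::real. t * ln (h t) / (t * ?L (of_real t))"
  have of_real: "filterlim complex_of_real (at 0) (at_right 0)"
    unfolding filterlim_at
    by (auto simp: eventually_at_filter intro!: tendsto_eq_intros)
  have "((\<lambda>t. cmod (of_real t) * ?L (of_real t)) \<longlongrightarrow> 1) (at_right 0)"
    by (rule filterlim_compose[OF ln_lp_opnorm_resolvent_tendsto[OF p] of_real])
  moreover have "eventually (\<lambda>t. cmod (of_real t) * ?L (of_real t) = t * ?L (of_real t)) (at_right 0)"
    using eventually_at_right_less[of 0] by eventually_elim simp
  ultimately have L: "((\<lambda>t. t * ?L (of_real t)) \<longlongrightarrow> 1) (at_right 0)"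
    by (rule Lim_transform_eventually)
  have "(?G \<longlongrightarrow> a / 1) (at_right 0)"
    by (intro tendsto_divide lim L) auto
  then have G: "((\<lambda>t. ereal (?G t)) \<longlongrightarrow> ereal a) (at_right 0)"
    by simp
  have "ereal a = Limsup (at_right 0) (\<lambda>t. ereal (?G t))"
    by (rule lim_imp_Limsup[OF _ G, symmetric]) simp
  also have "\<dots> \<le> Limsup (at_right 0) (\<lambda>t. ?f (of_real t))"
  proof (rule Limsup_mono)
    show "eventually (\<lambda>t. ereal (?G t) \<le> ?f (of_real t)) (at_right 0)"
      using le eventually_at_right_less[of 0] order_tendstoD(1)[OF L, of 0, simplified]
    proof eventually_elim
      case (elim t)
      then have "ln (h t) \<le> ln (lp_norm p (harmonic_resolvent (of_real t) x))"
        by (intro ln_mono) auto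
      then show ?case
        using elim lp_resolvent_eq_harmonic_resolvent[OF _ p x, of "of_real t"]
        by (auto simp: zero_less_mult_iff intro: divide_right_mono)
    qed
  qed
  also have "\<dots> \<le> Limsup (filtermap complex_of_real (at_right 0)) ?f"
    by (rule Limsup_filtermap_ge)
  also have "\<dots> \<le> Limsup (at 0) ?f"
    using of_real unfolding filterlim_def Limsup_def le_filter_def
    by (intro INF_superset_mono) auto
  finally show ?thesis
    by (simp only: lp_local_exponent_def)
qed


section \<open>The power set\<close>

lemma lp_local_exponent_le_1:
  assumes p: "1 \<le> p" and x: "x \<in> lp p" "x \<noteq> (\<lambda>n. 0)"
  shows "lp_local_exponent p harmonic_shift x \<le> ereal 1"
  using lp_local_exponent_le[OF p x lp_norm_pos[OF p x], of 1]
    lp_norm_harmonic_resolvent_le[OF _ p x(1)] by simp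

lemma lp_local_exponent_nonneg:
  assumes p: "1 \<le> p" and x: "x \<in> lp p" "x \<noteq> (\<lambda>n. 0)"
  shows "ereal 0 \<le> lp_local_exponent p harmonic_shift x"
proof -
  obtain n where n: "x n \<noteq> 0" using x(2) by auto
  show ?thesis
  proof (rule lp_local_exponent_ge[OF p x(1)])
    show "((\<lambda>t. t * ln (cmod (x n) / (t + 1))) \<longlongrightarrow> 0) (at_right 0)"
      using n by (auto intro!: tendsto_eq_intros)
    show "eventually (\<lambda>t. 0 < cmod (x n) / (t + 1) \<and> cmod (x n) / (t + 1)
        \<le> lp_norm p (harmonic_resolvent (of_real t) x)) (at_right 0)"
      using eventually_at_right_less[of 0]
    proof eventually_elim
      case (elim t)
      then show ?case
        using n cmod_le_lp_norm_harmonic_resolvent[OF _ p x(1), of "of_real t" n]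
        by (simp add: divide_le_eq mult.commute)
    qed
  qed
qed

text \<open>
  Since \<open>x (n + k) = a ^ k * x n\<close>, shifting by \<open>k\<close> only contributes the factor \<open>a ^ k\<close>, which rescales
  the exponential series dominating the resolvent from \<open>exp (1 / \<bar>z\<bar>)\<close> to \<open>exp (a / \<bar>z\<bar>)\<close>.
\<close>

lemma lp_local_exponent_geometric:
  assumes p: "1 \<le> p" and a: "0 \<le> a" "a < 1"
  defines "x \<equiv> \<lambda>n. complex_of_real (a ^ n)"
  shows "x \<in> lp p" "x \<noteq> (\<lambda>n. 0)" "lp_local_exponent p harmonic_shift x = ereal a"
proof -
  have norm_x: "cmod (x n) = a ^ n" for n
    using a by (simp only: x_def norm_of_real) simp
  show x: "x \<in> lp p"
    unfolding lp_def mem_Collect_eq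
  proof (rule summable_comparison_test'[where g = "\<lambda>n. a ^ n" and N = 0])
    show "summable (\<lambda>n. a ^ n)" using a by (simp add: summable_geometric)
    show "norm (cmod (x n) powr p) \<le> a ^ n" for n
      using powr_mono'[of 1 p "a ^ n"] a p by (simp add: norm_x power_le_one)
  qed
  show x0: "x \<noteq> (\<lambda>n. 0)"
    by (auto simp: x_def fun_eq_iff intro!: exI[of _ 0])
  show "lp_local_exponent p harmonic_shift x = ereal a"
  proof (rule antisym)
    show "lp_local_exponent p harmonic_shift x \<le> ereal a"
    proof (rule lp_local_exponent_le[OF p x x0 lp_norm_pos[OF p x x0]])
      fix z :: complex assume z: "z \<noteq> 0"
      let ?C = "exp (a / cmod z) / cmod z"
      let ?t = "\<lambda>n k. (fact n / fact (n + k)) * inverse z ^ Suc k * x (n + k)"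
      have C: "0 \<le> ?C" by simp
      have bound: "cmod (harmonic_resolvent z x n) \<le> ?C * cmod (x n)" for n
      proof -
        have s: "(\<lambda>k. res_coeff z k * cmod (x (n + k))) sums (?C * cmod (x n))"
          using sums_mult2[OF res_coeff_geometric_sums[OF z, of a], of "a ^ n"]
          by (simp add: norm_x power_add mult_ac)
        have sn: "summable (\<lambda>k. cmod (?t n k))"
          by (rule summable_comparison_test'[OF sums_summable[OF s]])
            (use res_term_le[OF z p] in simp)
        have "cmod (suminf (?t n)) \<le> (\<Sum>k. cmod (?t n k))"
          by (rule summable_norm[OF sn])
        also have "\<dots> \<le> ?C * cmod (x n)"
          by (rule sums_le[OF _ summable_sums[OF sn] s]) (rule res_term_le[OF z p])
        finally show ?thesis by (simp only: harmonic_resolvent_def)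
      qed
      have sx: "summable (\<lambda>n. cmod (x n) powr p)" using x by (simp add: lp_def)
      have "(\<Sum>n<N. cmod (harmonic_resolvent z x n) powr p) \<le> ?C powr p * (\<Sum>n. cmod (x n) powr p)" for N
      proof -
        have "(\<Sum>n<N. cmod (harmonic_resolvent z x n) powr p) \<le> (\<Sum>n<N. (?C * cmod (x n)) powr p)"
          using p bound by (intro sum_mono powr_mono2) auto
        also have "\<dots> = ?C powr p * (\<Sum>n<N. cmod (x n) powr p)"
          by (simp only: sum_distrib_left powr_mult)
        also have "\<dots> \<le> ?C powr p * (\<Sum>n. cmod (x n) powr p)"
          using sx by (intro mult_left_mono sum_le_suminf) auto
        finally show ?thesis .
      qed
      then show "lp_norm p (harmonic_resolvent z x) \<le> ?C * lp_norm p x"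
        by (rule lp_norm_leI(2)[OF p C x])
    qed
    show "ereal a \<le> lp_local_exponent p harmonic_shift x"
    proof (rule lp_local_exponent_ge[OF p x])
      have lim: "((\<lambda>t::real. a + t * ln (1 / t)) \<longlongrightarrow> a) (at_right 0)"
        by real_asymp
      have "eventually (\<lambda>t. a + t * ln (1 / t) = t * ln (exp (a / t) / t)) (at_right 0)"
        using eventually_at_right_less[of 0]
        by eventually_elim (simp add: ln_div algebra_simps)
      then show "((\<lambda>t. t * ln (exp (a / t) / t)) \<longlongrightarrow> a) (at_right 0)"
        using lim by (rule Lim_transform_eventually[rotated])
      show "eventually (\<lambda>t. 0 < exp (a / t) / t
          \<and> exp (a / t) / t \<le> lp_norm p (harmonic_resolvent (of_real t) x)) (at_right 0)"
        using eventually_at_right_less[of 0]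
      proof eventually_elim
        case (elim t)
        let ?R = "harmonic_resolvent (of_real t) x"
        have t: "complex_of_real t \<noteq> 0" using elim by simp
        have "(\<lambda>k. (a / t) ^ k /\<^sub>R fact k) sums exp (a / t)"
          by (rule exp_converges)
        then have "(\<lambda>k. complex_of_real ((a / t) ^ k /\<^sub>R fact k)) sums of_real (exp (a / t))"
          by (rule sums_of_real)
        moreover have "complex_of_real ((a / t) ^ k /\<^sub>R fact k)
            = inverse (of_real t) ^ k * x k / fact k" for k
          by (simp add: x_def divide_inverse power_mult_distrib mult_ac)
        ultimately have "of_real t * ?R 0 = of_real (exp (a / t))"
          using harmonic_resolvent_0_sums[OF t p x] by (simp only: sums_unique2)
        then have "?R 0 = of_real (exp (a / t) / t)"
          using t by (simp add: field_simps)
        then have "cmod (?R 0) = exp (a / t) / t"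
          using elim by (simp only: norm_of_real) simp
        then show ?case
          using elim cmod_le_lp_norm[OF harmonic_resolvent_in_lp[OF t p x] p, of 0] by simp
      qed
    qed
  qed
qed

lemma lp_local_exponent_damped:
  assumes p: "1 \<le> p"
  shows "lp_local_exponent p harmonic_shift (damped_powers 1) = ereal 1"
proof (rule antisym)
  have x: "damped_powers 1 \<in> lp p" using p by (intro damped_powers_in_lp) auto
  show "lp_local_exponent p harmonic_shift (damped_powers 1) \<le> ereal 1"
    by (rule lp_local_exponent_le_1[OF p x damped_powers_nonzero])
  show "ereal 1 \<le> lp_local_exponent p harmonic_shift (damped_powers 1)"
  proof (rule lp_local_exponent_ge[OF p x])
    let ?h = "\<lambda>t::real. (exp (1 / t) - 1 - 1 / t) * t"
    show "((\<lambda>t. t * ln (?h t)) \<longlongrightarrow> 1) (at_right 0)"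
      by real_asymp
    have "eventually (\<lambda>t. 0 < ?h t) (at_right 0)"
      by real_asymp
    then show "eventually (\<lambda>t. 0 < ?h t
        \<and> ?h t \<le> lp_norm p (harmonic_resolvent (of_real t) (damped_powers 1))) (at_right 0)"
      using eventually_at_right_less[of 0]
    proof eventually_elim
      case (elim t)
      have "sgn (complex_of_real t) = 1"
        using elim by (simp add: sgn_of_real)
      then show ?case
        using elim lp_norm_resolvent_damped_powers_ge[OF _ p, of "of_real t"] by simp
    qed
  qed
qed

theorem corollary3p5:
  fixes p :: real
  assumes "1 \<le> p"
  shows "lp_power_set p (backward_shift (\<lambda>n. 1 / (of_nat n + 1))) = {0..1}"
proof (intro equalityI subsetI)
  fix k assume "k \<in> lp_power_set p harmonic_shift"
  then show "k \<in> {0..1}"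
    using lp_local_exponent_nonneg[OF assms] lp_local_exponent_le_1[OF assms]
    by (auto simp: lp_power_set_def zero_ereal_def one_ereal_def)
next
  fix k :: ereal assume k: "k \<in> {0..1}"
  then obtain a where a: "k = ereal a" "0 \<le> a" "a \<le> 1"
    by (cases k) auto
  show "k \<in> lp_power_set p harmonic_shift"
  proof (cases "a = 1")
    case True
    then show ?thesis
      using lp_local_exponent_damped[OF assms] damped_powers_in_lp[of 1 p] damped_powers_nonzero assms a
      by (force simp: lp_power_set_def)
  next
    case False
    then have "a < 1" using a by simp
    then show ?thesis
      unfolding lp_power_set_def a(1)
      using lp_local_exponent_geometric[OF assms a(2)]
      by (intro image_eqI[where x = "\<lambda>n. complex_of_real (a ^ n)"]) auto
  qed
qed

end
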